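(* Let $G$ be the two-element group $(\mathbb{Z}_2,+)$. For every integer $n\ge0$, there is a bijection between the set of permutations in $\mathcal{S}_{n+1}$ that avoid the partially ordered generalized pattern $3$-$121$-$3$ and the set of partial $G$-partitions of $[n]$.
   Context: $[n]=\{1,\dots,n\}$; $\mathcal{S}_n$ is the set of permutations of $[n]$, written as words $a_1\dots a_n$. A partially ordered generalized pattern is a word $p_1p_2\dots p_m$ of positive integers (repetitions allowed) with a dash written between some of the consecutive letters. An occurrence of it in $\pi=a_1\dots a_n$ is a subsequence $a_{k_1}\dots a_{k_m}$, $k_1<\dots<k_m$, such that (a) $p_i>p_j$ implies $a_{k_i}>a_{k_j}$ for all $i,j$ (no condition when $p_i=p_j$), and (b) $k_{i+1}=k_i+1$ whenever $p_i$ and $p_{i+1}$ are not separated by a dash. $\pi$ avoids the pattern if it has no occurrence. For a group $G$, a $G$-labeled set $(A,\alpha)$ is a set $A$ together with a map $\alpha:A\to G$. Two $G$-labeled sets $(A,\alpha)$ and $(A,\beta)$ on the same set are equivalent if there is $g\in G$ with $\alpha=g\beta$ (i.e. $\alpha(a)=g\cdot\beta(a)$ for all $a\in A$; for $G=\mathbb{Z}_2$ written additively, $\alpha(a)=g+\beta(a)$). $[A,\alpha]$ denotes the equivalence class of $(A,\alpha)$. A partial $G$-partition of a set $S$ is a set $\{[A_1,\alpha_1],\dots,[A_k,\alpha_k]\}$ (with $k\ge0$) where $A_1,\dots,A_k$ are nonempty pairwise disjoint subsets of $S$ (their union need not be all of $S$). *)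

theory Defs
  imports
    "HOL-Library.Z2"
    "HOL-Library.FuncSet"
    "HOL-Library.Disjoint_Sets"
    "HOL-Combinatorics.Multiset_Permutations"
begin

section \<open>Partially ordered generalized patterns\<close>

text \<open>
  A pattern is a pair of its word of letters \<open>p\<^sub>1 \<dots> p\<^sub>m\<close> and the set of those \<open>i\<close>
  (counted from 1) for which a dash is written between \<open>p\<^sub>i\<close> and \<open>p\<^sub>i\<^sub>+\<^sub>1\<close>.
\<close>

type_synonym pogp = "nat list \<times> nat set"

text \<open>
  List positions are counted from 0, so the dash between \<open>p ! i\<close> and \<open>p ! Suc i\<close> is recorded
  by \<open>Suc i \<in> D\<close>. The list \<open>ks\<close> holds the positions of the occurrence in the word \<open>w\<close>.
\<close>

definition occurrence :: "pogp \<Rightarrow> nat list \<Rightarrow> nat list \<Rightarrow> bool" where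
  "occurrence P w ks \<longleftrightarrow> (case P of (p, D) \<Rightarrow>
     length ks = length p \<and> sorted_wrt (<) ks \<and> set ks \<subseteq> {..<length w} \<and>
     (\<forall>i < length p. \<forall>j < length p. p ! i > p ! j \<longrightarrow> w ! (ks ! i) > w ! (ks ! j)) \<and>
     (\<forall>i. Suc i < length p \<and> Suc i \<notin> D \<longrightarrow> ks ! Suc i = Suc (ks ! i)))"

definition avoids :: "nat list \<Rightarrow> pogp \<Rightarrow> bool" where
  "avoids w P \<longleftrightarrow> (\<nexists>ks. occurrence P w ks)"

definition pattern_3_121_3 :: pogp where
  "pattern_3_121_3 = ([3, 1, 2, 1, 3], {1, 4})"

section \<open>Partial $G$-partitions\<close>

text \<open>
  The group \<open>G\<close> is a type of class \<open>group_add\<close>. A labeling of \<open>A\<close> is an extensional function, so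
  that distinct pairs \<open>(A, \<alpha>)\<close> are distinct labeled sets.
\<close>

definition labeled_sets :: "('a set \<times> ('a \<Rightarrow> 'g)) set" where
  "labeled_sets = {(A, \<alpha>). \<alpha> \<in> A \<rightarrow>\<^sub>E UNIV}"

definition label_equiv ::
    "(('a set \<times> ('a \<Rightarrow> 'g :: group_add)) \<times> ('a set \<times> ('a \<Rightarrow> 'g))) set" where
  "label_equiv = {((A, \<alpha>), (B, \<beta>)). (A, \<alpha>) \<in> labeled_sets \<and> (B, \<beta>) \<in> labeled_sets \<and>
     A = B \<and> (\<exists>g. \<forall>a\<in>A. \<alpha> a = g + \<beta> a)}"

definition label_class ::
    "'a set \<Rightarrow> ('a \<Rightarrow> 'g :: group_add) \<Rightarrow> ('a set \<times> ('a \<Rightarrow> 'g)) set" where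
  "label_class A \<alpha> = label_equiv `` {(A, \<alpha>)}"

definition partial_G_partitions ::
    "'a set \<Rightarrow> ('a set \<times> ('a \<Rightarrow> 'g :: group_add)) set set set" where
  "partial_G_partitions S = {P. \<exists>(k::nat) A \<alpha>.
     P = (\<lambda>i. label_class (A i) (\<alpha> i)) ` {1..k} \<and>
     (\<forall>i\<in>{1..k}. A i \<noteq> {} \<and> A i \<subseteq> S \<and> (A i, \<alpha> i) \<in> labeled_sets) \<and>
     disjoint_family_on A {1..k}}"

lemma equiv_label_equiv: "equiv labeled_sets label_equiv"
proof (rule equivI)
  show "label_equiv \<subseteq> labeled_sets \<times> labeled_sets"
    by (auto simp: label_equiv_def)
  show "refl_on labeled_sets (label_equiv :: (('a set \<times> ('a \<Rightarrow> 'g :: group_add)) \<times> _) set)"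
    by (auto simp: refl_on_def label_equiv_def intro!: exI[of _ "0 :: 'g"])
  show "sym (label_equiv :: (('a set \<times> ('a \<Rightarrow> 'g :: group_add)) \<times> _) set)"
  proof (rule symI, clarify)
    fix A B :: "'a set" and \<alpha> \<beta> :: "'a \<Rightarrow> 'g"
    assume "((A, \<alpha>), (B, \<beta>)) \<in> label_equiv"
    then obtain g where AB: "A = B" "(A, \<alpha>) \<in> labeled_sets" "(B, \<beta>) \<in> labeled_sets"
      and g: "\<forall>a\<in>A. \<alpha> a = g + \<beta> a"
      by (auto simp: label_equiv_def)
    from g have "\<forall>a\<in>B. \<beta> a = - g + \<alpha> a"
      by (simp add: AB(1) add.assoc[symmetric])
    with AB show "((B, \<beta>), (A, \<alpha>)) \<in> label_equiv"
      unfolding label_equiv_def by blast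
  qed
  show "trans (label_equiv :: (('a set \<times> ('a \<Rightarrow> 'g :: group_add)) \<times> _) set)"
  proof (rule transI, clarify)
    fix A B C :: "'a set" and \<alpha> \<beta> \<gamma> :: "'a \<Rightarrow> 'g"
    assume 1: "((A, \<alpha>), (B, \<beta>)) \<in> label_equiv" and 2: "((B, \<beta>), (C, \<gamma>)) \<in> label_equiv"
    from 1 obtain g where g: "\<forall>a\<in>A. \<alpha> a = g + \<beta> a" by (auto simp: label_equiv_def)
    from 2 obtain h where h: "\<forall>a\<in>B. \<beta> a = h + \<gamma> a" by (auto simp: label_equiv_def)
    have "\<forall>a\<in>A. \<alpha> a = (g + h) + \<gamma> a"
      using g h 1 by (auto simp: label_equiv_def add.assoc)
    with 1 2 show "((A, \<alpha>), (C, \<gamma>)) \<in> label_equiv"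
      unfolding label_equiv_def by blast
  qed
qed

end

theory Submission
  imports Defs "HOL-Library.Cardinality"
begin

text \<open>
  A permutation of \<open>S \<union> {M}\<close> with \<open>M\<close> above \<open>S\<close> avoids 3-121-3 iff it is \<open>u M rev v\<close> with every
  interior peak of \<open>u\<close> and of \<open>v\<close> exceeding everything to its left: for a peak in front of \<open>M\<close>
  the letter \<open>M\<close> already plays the last 3, so nothing larger may precede the peak. Let \<open>q(S)\<close> be
  the number of such pairs \<open>(u, v)\<close>. If \<open>m\<close> is above \<open>S\<close> and occurs in \<open>u = u' m w\<close>, then \<open>w\<close> has
  no interior peak at all, and there are \<open>2\<^bsup>|W| - 1\<^esup>\<close> such words on a nonempty letter set \<open>W\<close>.
  Hence \<open>q(S \<union> {m}) = 2 \<Sum>\<^bsub>W\<subseteq>S\<^esub> card(peakless words on W) q(S - W)\<close>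
  \<open>= q(S) + \<Sum>\<^bsub>W\<subseteq>S\<^esub> 2\<^bsup>|W|\<^esup> q(S - W)\<close>.
  Partial \<open>G\<close>-partitions obey the same recurrence: either \<open>m\<close> lies in no block, or its block is
  \<open>W \<union> {m}\<close>, which carries \<open>|G|\<^bsup>|W|\<^esup>\<close> classes of labelings.
\<close>

section \<open>Peaks of words\<close>

definition peak :: "'a::linorder list \<Rightarrow> nat \<Rightarrow> bool" where
  "peak w i \<longleftrightarrow> 0 < i \<and> Suc i < length w \<and> w ! (i - 1) < w ! i \<and> w ! Suc i < w ! i"

definition peaks_left_max :: "'a::linorder list \<Rightarrow> bool" where
  "peaks_left_max w \<longleftrightarrow> (\<forall>i. peak w i \<longrightarrow> (\<forall>j<i. w ! j \<le> w ! i))"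

text \<open>The weak inequalities negate the strict ones that the letters 3 of the pattern demand,
  so the equivalence with avoidance holds for words with repeated letters as well.\<close>

definition peaks_left_or_right_max :: "'a::linorder list \<Rightarrow> bool" where
  "peaks_left_or_right_max w \<longleftrightarrow> (\<forall>i. peak w i \<longrightarrow>
     (\<forall>j<i. w ! j \<le> w ! i) \<or> (\<forall>j. i < j \<and> j < length w \<longrightarrow> w ! j \<le> w ! i))"

definition peakless :: "'a::linorder list \<Rightarrow> bool" where
  "peakless w \<longleftrightarrow> (\<forall>i. \<not> peak w i)"

text \<open>The undashed block 121 is a peak with its two neighbours, and the outer letters 3 are a
  letter larger than the peak on each side. Nothing is asked of the two 1s relative to each other,
  nor of the two 3s.\<close>

lemma avoids_3_121_3_iff: "avoids w pattern_3_121_3 \<longleftrightarrow> peaks_left_or_right_max w"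
proof
  assume av: "avoids w pattern_3_121_3"
  show "peaks_left_or_right_max w"
  proof (rule ccontr)
    assume "\<not> peaks_left_or_right_max w"
    then obtain i j k where i: "peak w i" and j: "j < i" "w ! i < w ! j"
      and k: "i < k" "k < length w" "w ! i < w ! k"
      unfolding peaks_left_or_right_max_def by (auto simp: not_le)
    \<comment> \<open>Both neighbours of a peak are smaller than it, so the larger letters at
      \<open>j\<close> and \<open>k\<close> lie further out and the five positions are strictly
      increasing.\<close>
    from i j have "j \<noteq> i - 1" by (auto simp: peak_def)
    moreover from i k have "k \<noteq> Suc i" by (auto simp: peak_def)
    ultimately have "occurrence pattern_3_121_3 w [j, i - 1, i, Suc i, k]"
      using i j k
      by (auto simp: occurrence_def pattern_3_121_3_def peak_def less_Suc_eq nth_Cons')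
    with av show False by (auto simp: avoids_def)
  qed
next
  assume ext: "peaks_left_or_right_max w"
  show "avoids w pattern_3_121_3"
    unfolding avoids_def
  proof
    assume "\<exists>ks. occurrence pattern_3_121_3 w ks"
    then obtain ks where occ: "occurrence pattern_3_121_3 w ks" by blast
    then have "length ks = 5" by (simp add: occurrence_def pattern_3_121_3_def)
    then obtain a b c d e where ks: "ks = [a, b, c, d, e]"
      by (auto simp: eval_nat_numeral length_Suc_conv)
    have gt: "[3, 1, 2, 1, 3::nat] ! i > [3, 1, 2, 1, 3] ! j \<longrightarrow> w ! (ks ! i) > w ! (ks ! j)"
      if "i < 5" "j < 5" for i j
      using occ that by (simp add: occurrence_def pattern_3_121_3_def)
    have adj: "Suc i < 5 \<and> Suc i \<notin> {1, 4} \<longrightarrow> ks ! Suc i = Suc (ks ! i)" for i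
      using occ by (simp add: occurrence_def pattern_3_121_3_def)
    have pos: "a < b" "b < c" "c < d" "d < e" "e < length w"
      using occ by (auto simp: ks occurrence_def)
    \<comment> \<open>Counted from 0, entry 2 of the pattern is its letter 2 and entries 1 and 3 are
      its letters 1; no dash separates these, so \<open>b\<close>, \<open>c\<close>,
      \<open>d\<close> are consecutive.\<close>
    have "peak w c"
      using gt[of 2 1] gt[of 2 3] adj[of 1] adj[of 2] pos by (simp add: ks peak_def)
    moreover have "w ! c < w ! a" "w ! c < w ! e"
      using gt[of 0 2] gt[of 4 2] by (simp_all add: ks)
    ultimately show False
      using ext pos unfolding peaks_left_or_right_max_def
      by (meson less_trans not_le)
  qed
qed

text \<open>The largest letter \<open>m\<close> is a peak as soon as it has two neighbours. The
  letters next to it are not peaks, just as they are not interior in \<open>u\<close> or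
  \<open>v\<close>; all others keep their neighbours.\<close>

lemma peak_append_max:
  assumes u: "\<forall>x\<in>set u. x < m" and v: "\<forall>x\<in>set v. x < m"
  shows "peak (u @ m # v) i \<longleftrightarrow>
    peak u i \<or> (i = length u \<and> u \<noteq> [] \<and> v \<noteq> []) \<or> (length u < i \<and> peak v (i - Suc (length u)))"
proof -
  consider "i < length u" | "i = length u" | "i = Suc (length u)" | "Suc (length u) < i"
    by linarith
  then show ?thesis
  proof cases
    case 1
    show ?thesis
    proof (cases "Suc i < length u")
      case True
      with 1 show ?thesis by (auto simp: peak_def nth_append)
    next
      case False
      with 1 have "Suc i = length u" by simp
      moreover have "u ! i < m" using u 1 by simp
      ultimately show ?thesis
        using 1 by (auto simp: peak_def nth_append)
    qed
  next
    case 2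
    have "u \<noteq> [] \<Longrightarrow> u ! (length u - Suc 0) < m" "v \<noteq> [] \<Longrightarrow> v ! 0 < m"
      using u v by auto
    with 2 show ?thesis by (cases "u = []") (auto simp: peak_def nth_append)
  next
    case 3
    have "v ! 0 < m" if "1 < length v"
      using v that by (cases v) auto
    then have "\<not> peak (u @ m # v) i" using 3 by (auto simp: peak_def nth_append)
    moreover have "\<not> peak u i" "\<not> peak v (i - Suc (length u))" using 3 by (simp_all add: peak_def)
    ultimately show ?thesis using 3 by simp
  next
    case 4
    then obtain k where "i = Suc (Suc (length u) + k)"
      using less_imp_Suc_add by blast
    then show ?thesis by (auto simp: peak_def nth_append)
  qed
qed

text \<open>Reversal exchanges the two neighbours of a letter, and the peak condition is symmetric
  in them.\<close>

lemma peak_rev: "peak (rev w) i \<longleftrightarrow> i < length w \<and> peak w (length w - Suc i)"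
proof (cases "0 < i \<and> Suc i < length w")
  case True
  have 1: "rev w ! i = w ! (length w - Suc i)" using True by (simp add: rev_nth)
  have "rev w ! (i - 1) = w ! (length w - Suc (i - 1))" using True by (subst rev_nth) auto
  also have "length w - Suc (i - 1) = Suc (length w - Suc i)" using True by linarith
  finally have 2: "rev w ! (i - 1) = w ! Suc (length w - Suc i)" .
  have "rev w ! (Suc i) = w ! (length w - Suc (Suc i))" using True by (subst rev_nth) auto
  then have 3: "rev w ! (Suc i) = w ! (length w - Suc i - 1)" by simp
  show ?thesis
    unfolding peak_def 1 2 3 using True by auto
next
  case False
  then show ?thesis by (auto simp: peak_def)
qed

text \<open>Every peak of \<open>v\<close> has the larger letter \<open>m\<close> on its left, so
  \<open>v\<close> can have none. Peaks of \<open>u\<close> see the same letters to their left as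
  before, and \<open>m\<close> itself exceeds everything.\<close>

lemma peaks_left_max_append_max:
  assumes u: "\<forall>x\<in>set u. x < m" and v: "\<forall>x\<in>set v. x < m"
  shows "peaks_left_max (u @ m # v) \<longleftrightarrow> peaks_left_max u \<and> peakless v"
proof
  assume L: "peaks_left_max (u @ m # v)"
  have "peaks_left_max u"
    unfolding peaks_left_max_def
  proof (intro allI impI)
    fix i j assume i: "peak u i" and j: "j < i"
    then have "(u @ m # v) ! j \<le> (u @ m # v) ! i"
      using L by (simp add: peaks_left_max_def peak_append_max[OF u v])
    with i j show "u ! j \<le> u ! i" by (simp add: peak_def nth_append)
  qed
  moreover have "\<not> peak v i" for i
  proof
    assume i: "peak v i"
    then have "peak (u @ m # v) (Suc (length u + i))" by (simp add: peak_append_max[OF u v])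
    then have "(u @ m # v) ! length u \<le> (u @ m # v) ! (Suc (length u + i))"
      using L unfolding peaks_left_max_def by (metis less_add_Suc1)
    then have "m \<le> v ! i" by (simp add: nth_append)
    moreover have "v ! i < m" using v i by (simp add: peak_def)
    ultimately show False by simp
  qed
  ultimately show "peaks_left_max u \<and> peakless v" by (simp add: peakless_def)
next
  assume uv: "peaks_left_max u \<and> peakless v"
  show "peaks_left_max (u @ m # v)"
    unfolding peaks_left_max_def
  proof (intro allI impI)
    fix i j assume i: "peak (u @ m # v) i" and j: "j < i"
    from i uv consider "peak u i" | "i = length u"
      by (auto simp: peak_append_max[OF u v] peakless_def)
    then show "(u @ m # v) ! j \<le> (u @ m # v) ! i"
    proof cases
      case 1
      then have "u ! j \<le> u ! i" using uv j by (simp add: peaks_left_max_def)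
      with 1 j show ?thesis by (simp add: nth_append peak_def)
    next
      case 2
      with u j have "u ! j \<le> m" by (auto intro: less_imp_le)
      with 2 j show ?thesis by (simp add: nth_append)
    qed
  qed
qed

text \<open>An interior \<open>m\<close> would be a peak, so it must stand at an end of the
  word.\<close>

lemma peakless_append_max:
  assumes "\<forall>x\<in>set u. x < m" and "\<forall>x\<in>set v. x < m"
  shows "peakless (u @ m # v) \<longleftrightarrow> peakless u \<and> peakless v \<and> (u = [] \<or> v = [])"
proof
  assume L: "peakless (u @ m # v)"
  have "\<not> peak v i" for i
    using L peak_append_max[OF assms, of "Suc (length u + i)"] by (simp add: peakless_def)
  with L show "peakless u \<and> peakless v \<and> (u = [] \<or> v = [])"
    by (auto simp: peakless_def peak_append_max[OF assms])
next
  assume "peakless u \<and> peakless v \<and> (u = [] \<or> v = [])"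
  then show "peakless (u @ m # v)"
    unfolding peakless_def peak_append_max[OF assms] by blast
qed

text \<open>A peak in front of \<open>m\<close> has \<open>m\<close> on its right and must dominate
  its left side; a peak behind \<open>m\<close> must dominate its right side. Writing the second
  half as \<open>rev v\<close> turns both requirements into the same left condition.\<close>

lemma peaks_left_or_right_max_append_max:
  assumes u: "\<forall>x\<in>set u. x < m" and v: "\<forall>x\<in>set v. x < m"
  shows "peaks_left_or_right_max (u @ m # rev v) \<longleftrightarrow> peaks_left_max u \<and> peaks_left_max v"
proof -
  let ?w = "u @ m # rev v"
  have v': "\<forall>x\<in>set (rev v). x < m" using v by simp
  note pk = peak_append_max[OF u v']
  show ?thesis
  proof
    assume L: "peaks_left_or_right_max ?w"
    have "peaks_left_max u"
      unfolding peaks_left_max_def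
    proof (intro allI impI)
      fix i j assume i: "peak u i" and j: "j < i"
      have "peak ?w i" using i by (simp add: pk)
      \<comment> \<open>The letter \<open>m\<close> at position \<open>length u\<close> rules out
        the right-hand alternative for this peak.\<close>
      moreover have "\<not> ?w ! length u \<le> ?w ! i" "i < length u"
        using u i by (simp_all add: nth_append peak_def not_le)
      moreover have "length u < length ?w" by simp
      ultimately have "?w ! j \<le> ?w ! i"
        using L j unfolding peaks_left_or_right_max_def by blast
      with i j show "u ! j \<le> u ! i" by (simp add: peak_def nth_append)
    qed
    moreover have "peaks_left_max v"
      unfolding peaks_left_max_def
    proof (intro allI impI)
      fix i j assume i: "peak v i" and j: "j < i"
      \<comment> \<open>\<open>?f\<close> takes a position in \<open>v\<close> to the place of the
        same letter in \<open>?w\<close>; on positions of \<open>v\<close> it reverses the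
        order.\<close>
      let ?f = "\<lambda>i. Suc (length u + (length v - Suc i))"
      have l: "i < length v" using i by (simp add: peak_def)
      have nth: "?w ! ?f k = v ! k" if "k < length v" for k
      proof -
        have "?f k - length u = Suc (length v - Suc k)" "\<not> ?f k < length u" by linarith+
        then show ?thesis using that by (simp only: nth_append) (simp add: rev_nth)
      qed
      have "peak (rev v) (length v - Suc i)" using i l by (simp add: peak_rev)
      then have "peak ?w (?f i)" unfolding pk by simp
      \<comment> \<open>Here \<open>m\<close> stands to the left of the peak and rules out the
        left-hand alternative.\<close>
      moreover have "\<not> ?w ! length u \<le> ?w ! ?f i"
        using v l by (subst nth) (auto simp: not_le)
      moreover have "length u < ?f i" by simp
      moreover have "?f i < ?f j" "?f j < length ?w" using j l by auto
      ultimately have "?w ! ?f j \<le> ?w ! ?f i"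
        using L unfolding peaks_left_or_right_max_def by blast
      then show "v ! j \<le> v ! i" using j l by (simp only: nth less_trans)
    qed
    ultimately show "peaks_left_max u \<and> peaks_left_max v" ..
  next
    assume uv: "peaks_left_max u \<and> peaks_left_max v"
    show "peaks_left_or_right_max ?w"
      unfolding peaks_left_or_right_max_def
    proof (intro allI impI)
      fix i assume "peak ?w i"
      then consider "peak u i" | "i = length u"
        | "length u < i" "peak (rev v) (i - Suc (length u))"
        by (auto simp: pk)
      then show "(\<forall>j<i. ?w ! j \<le> ?w ! i) \<or> (\<forall>j. i < j \<and> j < length ?w \<longrightarrow> ?w ! j \<le> ?w ! i)"
      proof cases
        case 1
        then have "\<forall>j<i. u ! j \<le> u ! i" using uv by (simp add: peaks_left_max_def)
        with 1 show ?thesis by (auto simp: nth_append peak_def)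
      next
        case 2
        with u show ?thesis by (auto simp: nth_append intro: less_imp_le)
      next
        case 3
        define k where "k = i - Suc (length u)"
        have i: "i = Suc (length u + k)" using 3 by (simp add: k_def)
        have k: "k < length v" "peak v (length v - Suc k)"
          using 3 by (auto simp: k_def peak_rev)
        have "?w ! j \<le> ?w ! i" if "i < j" "j < length ?w" for j
        proof -
          define l where "l = j - Suc (length u)"
          have j: "j = Suc (length u + l)" and l: "k < l" "l < length v"
            using that i by (auto simp: l_def)
          have "v ! (length v - Suc l) \<le> v ! (length v - Suc k)"
            using uv k l by (auto simp: peaks_left_max_def)
          then show ?thesis using k l by (simp add: i j nth_append rev_nth)
        qed
        then show ?thesis by blast
      qed
    qed
  qed
qed

section \<open>Counting the avoiding permutations\<close>

definition peakless_words :: "'a::linorder set \<Rightarrow> 'a list set" where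
  "peakless_words W = {w \<in> permutations_of_set W. peakless w}"

definition left_max_pairs :: "'a::linorder set \<Rightarrow> ('a list \<times> 'a list) set" where
  "left_max_pairs S = {(u, v). distinct (u @ v) \<and> set (u @ v) = S \<and>
     peaks_left_max u \<and> peaks_left_max v}"

lemma finite_peakless_words: "finite W \<Longrightarrow> finite (peakless_words W)"
  by (simp add: peakless_words_def)

lemma finite_left_max_pairs:
  assumes "finite S"
  shows "finite (left_max_pairs S)"
proof (rule finite_subset)
  let ?X = "{xs. set xs \<subseteq> S \<and> length xs \<le> card S}"
  show "left_max_pairs S \<subseteq> ?X \<times> ?X"
    using assms
    by (auto simp: left_max_pairs_def distinct_card[symmetric] intro!: card_mono)
  show "finite (?X \<times> ?X)" using finite_lists_length_le[OF assms] by blast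
qed

text \<open>
  The maximum of a peakless word stands at one of its ends. Truncated subtraction gives the correct
  value 1 for the empty set.
\<close>
lemma card_peakless_words:
  assumes "finite W"
  shows "card (peakless_words W) = 2 ^ (card W - 1)"
  using assms
proof (induction W rule: finite_linorder_max_induct)
  case empty
  have "peakless_words {} = {[] :: 'a list}"
    by (auto simp: peakless_words_def peakless_def peak_def)
  then show ?case by simp
next
  case (insert m W)
  let ?L = "(#) m ` peakless_words W" and ?R = "(\<lambda>w. w @ [m]) ` peakless_words W"
  have m: "m \<notin> W" using insert by blast
  have p0: "peakless ([] :: 'a list)" by (simp add: peakless_def peak_def)
  have L: "?L \<subseteq> peakless_words (insert m W)"
    using insert peakless_append_max[of "[]" m] p0 m
    by (auto simp: peakless_words_def permutations_of_set_def)
  have R: "?R \<subseteq> peakless_words (insert m W)"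
    using insert peakless_append_max[of _ m "[]"] p0 m
    by (auto simp: peakless_words_def permutations_of_set_def)
  have "w \<in> ?L \<union> ?R" if w: "w \<in> peakless_words (insert m W)" for w
  proof -
    from w have "m \<in> set w" by (auto simp: peakless_words_def permutations_of_set_def)
    then obtain u v where uv: "w = u @ m # v" by (auto dest: split_list)
    with w have d: "distinct (u @ m # v)" "set (u @ m # v) = insert m W" "peakless (u @ m # v)"
      by (auto simp: peakless_words_def permutations_of_set_def)
    then have W: "set u \<union> set v = W" using m by auto
    with insert have "\<forall>x\<in>set u. x < m" "\<forall>x\<in>set v. x < m" by auto
    from d(3) peakless_append_max[OF this] have "peakless u" "peakless v" "u = [] \<or> v = []"
      by auto
    with d(1) W uv show ?thesis by (auto simp: peakless_words_def permutations_of_set_def)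
  qed
  with L R have eq: "peakless_words (insert m W) = ?L \<union> ?R" by blast
  show ?case
  \<comment> \<open>For empty \<open>W\<close> the words with \<open>m\<close> in front and with
    \<open>m\<close> at the back coincide; otherwise they are disjoint families and the count
    doubles.\<close>
  proof (cases "W = {}")
    case True
    then have "peakless_words W = {[]}"
      by (auto simp: peakless_words_def p0)
    with eq True show ?thesis by simp
  next
    case False
    have "?L \<inter> ?R = {}"
    proof -
      \<comment> \<open>Since \<open>W\<close> is nonempty, so is \<open>w'\<close>; equality would
        make \<open>m\<close> its first letter.\<close>
      have "m # w \<noteq> w' @ [m]" if "w \<in> peakless_words W" "w' \<in> peakless_words W" for w w'
        using that False m
        by (cases w') (auto simp: peakless_words_def permutations_of_set_def)
      then show ?thesis by blast
    qed
    then have "card (peakless_words (insert m W)) = card ?L + card ?R"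
      unfolding eq using insert by (intro card_Un_disjoint) (auto simp: finite_peakless_words)
    also have "card ?L = card (peakless_words W)" by (intro card_image) auto
    also have "card ?R = card (peakless_words W)" by (intro card_image) (auto simp: inj_on_def)
    finally have "card (peakless_words (insert m W)) = 2 * 2 ^ (card W - 1)"
      using insert by simp
    also have "\<dots> = 2 ^ card W"
      using False insert by (metis One_nat_def Suc_pred card_gt_0_iff power_Suc)
    finally show ?thesis using insert m by simp
  qed
qed

text \<open>The inverse cuts the word at \<open>M\<close>, which occurs exactly once, and reverses
  what follows.\<close>

lemma bij_betw_left_max_pairs:
  assumes M: "\<forall>x\<in>S. x < M"
  shows "bij_betw (\<lambda>(u, v). u @ M # rev v) (left_max_pairs S)
    {w \<in> permutations_of_set (insert M S). peaks_left_or_right_max w}"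
  (is "bij_betw ?f _ ?P")
proof (rule bij_betw_imageI)
  have "M \<notin> S" using M by blast
  show "inj_on ?f (left_max_pairs S)"
  proof (rule inj_onI)
    fix p q assume pq: "p \<in> left_max_pairs S" "q \<in> left_max_pairs S" "?f p = ?f q"
    obtain u v u' v' where p: "p = (u, v)" "q = (u', v')" by (cases p, cases q) auto
    have "M \<notin> set u" "M \<notin> set (rev v)"
      using pq(1) \<open>M \<notin> S\<close> by (auto simp: p left_max_pairs_def)
    from append_Cons_eq_iff[OF this] pq(3) show "p = q" by (simp add: p)
  qed
  show "?f ` left_max_pairs S = ?P"
  proof (intro subset_antisym subsetI)
    fix w assume "w \<in> ?f ` left_max_pairs S"
    then obtain u v where w: "w = u @ M # rev v" and uv: "(u, v) \<in> left_max_pairs S" by auto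
    have "\<forall>x\<in>set u. x < M" "\<forall>x\<in>set v. x < M"
      using uv M by (auto simp: left_max_pairs_def)
    from peaks_left_or_right_max_append_max[OF this] uv \<open>M \<notin> S\<close>
    show "w \<in> ?P"
      by (auto simp: w left_max_pairs_def permutations_of_set_def)
  next
    fix w assume w: "w \<in> ?P"
    then have "M \<in> set w" by (auto simp: permutations_of_set_def)
    then obtain u v where "w = u @ M # v" by (auto dest: split_list)
    \<comment> \<open>From here on \<open>v\<close> denotes the reversal of the right-hand
      piece.\<close>
    then obtain v where wuv: "w = u @ M # rev v" by (metis rev_rev_ident)
    with w have d: "distinct (u @ M # rev v)" "set (u @ M # rev v) = insert M S"
      by (auto simp: permutations_of_set_def)
    then have S: "set u \<union> set v = S" using \<open>M \<notin> S\<close> by auto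
    with M have "\<forall>x\<in>set u. x < M" "\<forall>x\<in>set v. x < M" by auto
    from peaks_left_or_right_max_append_max[OF this] w d S
    have "(u, v) \<in> left_max_pairs S" by (auto simp: left_max_pairs_def wuv)
    with wuv show "w \<in> ?f ` left_max_pairs S" by force
  qed
qed

text \<open>Cutting the first word at its maximum \<open>m\<close> leaves a prefix of the same kind
  and a peakless suffix. The letter set \<open>W\<close> of the suffix indexes the summands of the
  recurrence.\<close>

lemma bij_betw_left_max_pairs_insert:
  assumes m: "\<forall>x\<in>S. x < m"
  shows "bij_betw (\<lambda>(W, w, u, v). (u @ m # w, v))
    (SIGMA W:Pow S. peakless_words W \<times> left_max_pairs (S - W))
    {(u, v) \<in> left_max_pairs (insert m S). m \<in> set u}"
  (is "bij_betw ?f ?A ?B")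
proof (rule bij_betw_imageI)
  have "m \<notin> S" using m by blast
  show "inj_on ?f ?A"
    using \<open>m \<notin> S\<close>
    by (intro inj_onI)
      (auto simp: left_max_pairs_def peakless_words_def permutations_of_set_def
        dest!: append_Cons_eq_iff[THEN iffD1, rotated -1])
  show "?f ` ?A = ?B"
  proof (intro subset_antisym subsetI)
    fix p assume "p \<in> ?f ` ?A"
    then obtain W w u v where p: "p = (u @ m # w, v)" and W: "W \<subseteq> S" "w \<in> peakless_words W"
      and uv: "(u, v) \<in> left_max_pairs (S - W)" by auto
    have "set u \<subseteq> S - W" "set w \<subseteq> W"
      using W uv by (auto simp: left_max_pairs_def peakless_words_def permutations_of_set_def)
    then have "\<forall>x\<in>set u. x < m" "\<forall>x\<in>set w. x < m" using W m by auto
    from peaks_left_max_append_max[OF this] W uv \<open>m \<notin> S\<close>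
    show "p \<in> ?B"
      by (auto simp: p left_max_pairs_def peakless_words_def permutations_of_set_def)
  next
    fix p assume p: "p \<in> ?B"
    then obtain t v where p_eq: "p = (t, v)" and "m \<in> set t" by auto
    then obtain u w where t: "t = u @ m # w" by (auto dest: split_list)
    with p p_eq have d: "distinct ((u @ m # w) @ v)" "set ((u @ m # w) @ v) = insert m S"
      "peaks_left_max (u @ m # w)" "peaks_left_max v"
      by (auto simp: left_max_pairs_def)
    then have S: "set u \<union> set w \<union> set v = S" using \<open>m \<notin> S\<close> by auto
    with m have "\<forall>x\<in>set u. x < m" "\<forall>x\<in>set w. x < m" by auto
    from peaks_left_max_append_max[OF this] d S
    have "(set w, w, u, v) \<in> ?A"
      by (auto simp: left_max_pairs_def peakless_words_def permutations_of_set_def)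
    then show "p \<in> ?f ` ?A" by (rule rev_image_eqI) (simp add: p_eq t)
  qed
qed

text \<open>The letter \<open>m\<close> lies in exactly one of the two words, and swapping the words
  exchanges the two cases; this gives the factor 2.\<close>

lemma card_left_max_pairs_insert:
  assumes S: "finite S" and m: "\<forall>x\<in>S. x < m"
  shows "card (left_max_pairs (insert m S)) =
    2 * (\<Sum>W\<in>Pow S. 2 ^ (card W - 1) * card (left_max_pairs (S - W)))"
proof -
  let ?B = "{(u, v) \<in> left_max_pairs (insert m S). m \<in> set u}"
  have fin: "finite ?B"
    using S by (intro finite_subset[OF _ finite_left_max_pairs[of "insert m S"]]) auto
  have sym: "(v, u) \<in> left_max_pairs (insert m S)" if "(u, v) \<in> left_max_pairs (insert m S)" for u v
    using that by (auto simp: left_max_pairs_def)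
  have eq: "left_max_pairs (insert m S) = ?B \<union> prod.swap ` ?B"
  proof (intro subset_antisym subsetI)
    fix p assume p: "p \<in> left_max_pairs (insert m S)"
    then have "m \<in> set (fst p) \<or> m \<in> set (snd p)"
      by (auto simp: left_max_pairs_def)
    with p sym have "p \<in> ?B \<or> prod.swap p \<in> ?B" by (cases p) auto
    then show "p \<in> ?B \<union> prod.swap ` ?B"
    proof
      assume "prod.swap p \<in> ?B"
      then have "prod.swap (prod.swap p) \<in> prod.swap ` ?B" by (rule imageI)
      then show ?thesis by simp
    qed simp
  qed (use sym in auto)
  have "?B \<inter> prod.swap ` ?B = {}"
    by (auto simp: left_max_pairs_def)
  with fin have "card (?B \<union> prod.swap ` ?B) = card ?B + card (prod.swap ` ?B)"
    by (intro card_Un_disjoint finite_imageI)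
  with eq have "card (left_max_pairs (insert m S)) = card ?B + card (prod.swap ` ?B)"
    by (rule ssubst)
  also have "card (prod.swap ` ?B) = card ?B" by (intro card_image) auto
  also have "card ?B + card ?B = 2 * card ?B" by simp
  also have "card ?B = card (SIGMA W:Pow S. peakless_words W \<times> left_max_pairs (S - W))"
    by (rule bij_betw_same_card[OF bij_betw_left_max_pairs_insert[OF m], symmetric])
  also have "\<dots> = (\<Sum>W\<in>Pow S. card (peakless_words W \<times> left_max_pairs (S - W)))"
    using S by (intro card_SigmaI)
      (auto intro!: finite_cartesian_product finite_peakless_words finite_left_max_pairs
        dest: finite_subset)
  also have "\<dots> = (\<Sum>W\<in>Pow S. 2 ^ (card W - 1) * card (left_max_pairs (S - W)))"
    using S by (intro sum.cong)
      (auto simp: card_cartesian_product card_peakless_words dest: finite_subset)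
  finally show ?thesis .
qed

section \<open>Counting partial $G$-partitions\<close>

definition label_classes :: "'a set \<Rightarrow> ('a set \<times> ('a \<Rightarrow> 'g::group_add)) set set" where
  "label_classes A = label_class A ` (A \<rightarrow>\<^sub>E UNIV)"

text \<open>All members of a class of labeled sets share the same underlying set, so the union
  recovers it without choosing a representative.\<close>

definition class_support :: "('a set \<times> ('a \<Rightarrow> 'g::group_add)) set \<Rightarrow> 'a set" where
  "class_support c = \<Union> (fst ` c)"

lemma class_support_label_class:
  assumes "\<alpha> \<in> A \<rightarrow>\<^sub>E UNIV"
  shows "class_support (label_class A (\<alpha> :: 'a \<Rightarrow> 'g::group_add)) = A"
proof -
  have "(A, \<alpha>) \<in> label_class A \<alpha>"
    using assms equiv_class_self[OF equiv_label_equiv]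
    by (force simp: label_class_def labeled_sets_def)
  moreover have "fst p = A" if "p \<in> label_class A \<alpha>" for p
    using that by (auto simp: label_class_def label_equiv_def)
  ultimately show ?thesis by (force simp: class_support_def)
qed

lemma class_support_label_classes: "c \<in> label_classes A \<Longrightarrow> class_support c = A"
  by (auto simp: label_classes_def class_support_label_class)

text \<open>This form has no indexing, so blocks can be added and removed as set elements. It is
  available because each class determines its own underlying set.\<close>

lemma partial_G_partitions_eq:
  "(partial_G_partitions S :: ('a set \<times> ('a \<Rightarrow> 'g::group_add)) set set set) =
    {P. finite P \<and> (\<forall>c\<in>P. c \<in> label_classes (class_support c) \<and>
          class_support c \<noteq> {} \<and> class_support c \<subseteq> S) \<and>
        disjoint_family_on class_support P}"
  (is "_ = ?R")
proof (intro subset_antisym subsetI)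
  fix P :: "('a set \<times> ('a \<Rightarrow> 'g::group_add)) set set"
  assume "P \<in> partial_G_partitions S"
  then obtain k :: nat and A \<alpha> where P: "P = (\<lambda>i. label_class (A i) (\<alpha> i)) ` {1..k}"
    and A: "\<And>i. i \<in> {1..k} \<Longrightarrow> A i \<noteq> {} \<and> A i \<subseteq> S \<and> \<alpha> i \<in> A i \<rightarrow>\<^sub>E UNIV"
    and d: "disjoint_family_on A {1..k}"
    by (auto simp: partial_G_partitions_def labeled_sets_def)
  have s: "class_support (label_class (A i) (\<alpha> i)) = A i" if "i \<in> {1..k}" for i
    using A[OF that] by (simp add: class_support_label_class)
  have "disjoint_family_on class_support P"
    unfolding disjoint_family_on_def P
  proof (intro ballI impI)
    fix c c' assume "c \<in> (\<lambda>i. label_class (A i) (\<alpha> i)) ` {1..k}"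
      "c' \<in> (\<lambda>i. label_class (A i) (\<alpha> i)) ` {1..k}" and ne: "c \<noteq> c'"
    then obtain i j where ij: "i \<in> {1..k}" "j \<in> {1..k}"
      and c: "c = label_class (A i) (\<alpha> i)" "c' = label_class (A j) (\<alpha> j)" by blast
    with ne have "i \<noteq> j" by auto
    with d ij show "class_support c \<inter> class_support c' = {}"
      unfolding c by (simp add: s[OF ij(1)] s[OF ij(2)] disjoint_family_on_def)
  qed
  moreover have "c \<in> label_classes (class_support c) \<and> class_support c \<noteq> {} \<and> class_support c \<subseteq> S"
    if "c \<in> P" for c
  proof -
    from that obtain i where i: "i \<in> {1..k}" and c: "c = label_class (A i) (\<alpha> i)"
      unfolding P by blast
    show ?thesis unfolding c s[OF i] using A[OF i] by (auto simp: label_classes_def)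
  qed
  ultimately show "P \<in> ?R" by (auto simp: P)
next
  fix P :: "('a set \<times> ('a \<Rightarrow> 'g::group_add)) set set"
  assume P: "P \<in> ?R"
  \<comment> \<open>The enumeration has no repetitions, so distinct indices give distinct classes
    and hence disjoint supports.\<close>
  then obtain h where h: "bij_betw h {1..card P} P"
    using ex_bij_betw_nat_finite_1 by blast
  define A where "A i = class_support (h i)" for i
  have "\<forall>i\<in>{1..card P}. \<exists>\<alpha>. \<alpha> \<in> A i \<rightarrow>\<^sub>E UNIV \<and> h i = label_class (A i) \<alpha>"
  proof
    fix i assume "i \<in> {1..card P}"
    with h have "h i \<in> P" by (rule bij_betw_apply)
    with P have "h i \<in> label_classes (A i)" by (simp add: A_def)
    then show "\<exists>\<alpha>. \<alpha> \<in> A i \<rightarrow>\<^sub>E UNIV \<and> h i = label_class (A i) \<alpha>"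
      by (auto simp: label_classes_def)
  qed
  then obtain \<alpha> where \<alpha>: "\<And>i. i \<in> {1..card P} \<Longrightarrow>
      \<alpha> i \<in> A i \<rightarrow>\<^sub>E UNIV \<and> h i = label_class (A i) (\<alpha> i)"
    by metis
  have "P = h ` {1..card P}" using h by (simp add: bij_betw_def)
  also have "\<dots> = (\<lambda>i. label_class (A i) (\<alpha> i)) ` {1..card P}"
    using \<alpha> by (intro image_cong) auto
  finally have "P = (\<lambda>i. label_class (A i) (\<alpha> i)) ` {1..card P}" .
  moreover have "\<forall>i\<in>{1..card P}. A i \<noteq> {} \<and> A i \<subseteq> S \<and> (A i, \<alpha> i) \<in> labeled_sets"
  proof
    fix i assume i: "i \<in> {1..card P}"
    with h have "h i \<in> P" by (rule bij_betw_apply)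
    with P have "A i \<noteq> {} \<and> A i \<subseteq> S" by (simp add: A_def)
    with \<alpha>[OF i] show "A i \<noteq> {} \<and> A i \<subseteq> S \<and> (A i, \<alpha> i) \<in> labeled_sets"
      by (simp add: labeled_sets_def)
  qed
  moreover have "disjoint_family_on A {1..card P}"
    unfolding disjoint_family_on_def A_def
  proof (intro ballI impI)
    fix i j assume ij: "i \<in> {1..card P}" "j \<in> {1..card P}" "i \<noteq> j"
    have "h i \<in> P" "h j \<in> P" by (rule bij_betw_apply[OF h], fact)+
    moreover have "h i \<noteq> h j"
      using inj_on_eq_iff[OF bij_betw_imp_inj_on[OF h] ij(1,2)] ij(3) by simp
    moreover have "disjoint_family_on class_support P" using P by simp
    ultimately show "class_support (h i) \<inter> class_support (h j) = {}"
      by (simp add: disjoint_family_on_def)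
  qed
  ultimately show "P \<in> partial_G_partitions S"
    unfolding partial_G_partitions_def by (intro CollectI exI conjI)
qed

text \<open>Each class on \<open>insert x A\<close> has a unique representative with label 0 at \<open>x\<close>.\<close>
lemma card_label_classes_insert:
  assumes A: "finite A" "x \<notin> A" and G: "finite (UNIV :: 'g::group_add set)"
  shows "card (label_classes (insert x A) :: ('a set \<times> ('a \<Rightarrow> 'g)) set set) = CARD('g) ^ card A"
proof -
  let ?f = "\<lambda>\<alpha> :: 'a \<Rightarrow> 'g. label_class (insert x A) (\<alpha>(x := 0))"
  have eq: "label_class B \<alpha> = label_class B \<beta> \<longleftrightarrow> (\<exists>g. \<forall>a\<in>B. \<alpha> a = g + \<beta> a)"
    if "\<alpha> \<in> B \<rightarrow>\<^sub>E UNIV" "\<beta> \<in> B \<rightarrow>\<^sub>E UNIV" for B :: "'a set" and \<alpha> \<beta> :: "'a \<Rightarrow> 'g"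
    using that eq_equiv_class_iff[OF equiv_label_equiv, of "(B, \<alpha>)" "(B, \<beta>)"]
    by (simp add: label_class_def labeled_sets_def label_equiv_def)
  have "inj_on ?f (A \<rightarrow>\<^sub>E UNIV)"
  proof (rule inj_onI)
    fix \<alpha> \<beta> :: "'a \<Rightarrow> 'g"
    assume \<alpha>: "\<alpha> \<in> A \<rightarrow>\<^sub>E UNIV" and \<beta>: "\<beta> \<in> A \<rightarrow>\<^sub>E UNIV" and "?f \<alpha> = ?f \<beta>"
    moreover have "\<alpha>(x := 0) \<in> insert x A \<rightarrow>\<^sub>E UNIV" "\<beta>(x := 0) \<in> insert x A \<rightarrow>\<^sub>E UNIV"
      using \<alpha> \<beta> by (auto simp: PiE_def extensional_def)
    ultimately obtain g where g: "\<forall>a\<in>insert x A. (\<alpha>(x := 0)) a = g + (\<beta>(x := 0)) a"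
      using eq by blast
    \<comment> \<open>Both labelings have the value 0 at \<open>x\<close>, so evaluating there
      determines \<open>g\<close>.\<close>
    then have "g = 0" by simp
    with g A have "\<forall>a\<in>A. \<alpha> a = \<beta> a" by (metis add_0 fun_upd_apply insertCI)
    with \<alpha> \<beta> show "\<alpha> = \<beta>" by (intro PiE_ext) auto
  qed
  moreover have "?f ` (A \<rightarrow>\<^sub>E UNIV) = label_classes (insert x A)"
  proof (intro subset_antisym subsetI)
    fix c assume "c \<in> ?f ` (A \<rightarrow>\<^sub>E UNIV)"
    then show "c \<in> label_classes (insert x A)"
      by (auto simp: label_classes_def PiE_def extensional_def intro!: imageI)
  next
    fix c :: "('a set \<times> ('a \<Rightarrow> 'g)) set" assume "c \<in> label_classes (insert x A)"
    then obtain \<alpha> where \<alpha>: "\<alpha> \<in> insert x A \<rightarrow>\<^sub>E UNIV" and c: "c = label_class (insert x A) \<alpha>"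
      by (auto simp: label_classes_def)
    \<comment> \<open>Translating on the left by \<open>- \<alpha> x\<close> makes the label at
      \<open>x\<close> equal to 0.\<close>
    define \<beta> where "\<beta> = restrict (\<lambda>a. - \<alpha> x + \<alpha> a) A"
    have "\<beta>(x := 0) \<in> insert x A \<rightarrow>\<^sub>E UNIV" by (auto simp: \<beta>_def PiE_def extensional_def)
    moreover have "\<forall>a\<in>insert x A. \<alpha> a = \<alpha> x + (\<beta>(x := 0)) a"
      by (auto simp: \<beta>_def add.assoc[symmetric])
    ultimately have "c = ?f \<beta>" unfolding c using eq[OF \<alpha>] by blast
    moreover have "\<beta> \<in> A \<rightarrow>\<^sub>E UNIV" by (simp add: \<beta>_def)
    ultimately show "c \<in> ?f ` (A \<rightarrow>\<^sub>E UNIV)" by blast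
  qed
  ultimately have "card (label_classes (insert x A) :: ('a set \<times> ('a \<Rightarrow> 'g)) set set) =
      card (A \<rightarrow>\<^sub>E (UNIV :: 'g set))"
    by (metis card_image)
  with A show ?thesis by (simp add: card_PiE)
qed

section \<open>Finiteness and the recurrence for partial G-partitions\<close>

lemma finite_label_classes:
  assumes "finite A" "finite (UNIV :: 'g::group_add set)"
  shows "finite (label_classes A :: ('a set \<times> ('a \<Rightarrow> 'g)) set set)"
  using assms by (simp add: label_classes_def finite_PiE)

lemma finite_partial_G_partitions:
  assumes "finite S" "finite (UNIV :: 'g::group_add set)"
  shows "finite (partial_G_partitions S :: ('a set \<times> ('a \<Rightarrow> 'g)) set set set)"
proof (rule finite_subset)
  show "(partial_G_partitions S :: ('a set \<times> ('a \<Rightarrow> 'g)) set set set) \<subseteq>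
      Pow (\<Union>A\<in>Pow S. label_classes A)"
    by (auto simp: partial_G_partitions_eq)
  show "finite (Pow (\<Union>A\<in>Pow S. label_classes A :: ('a set \<times> ('a \<Rightarrow> 'g)) set set))"
    using assms by (auto intro!: finite_label_classes dest: finite_subset)
qed

text \<open>The class whose support contains \<open>x\<close> is unique by disjointness. It can
  therefore be split off again, leaving a partial partition of the letters outside its
  support.\<close>

lemma bij_betw_partial_G_partitions_insert:
  assumes x: "x \<notin> S"
  shows "bij_betw (\<lambda>(A, c, P). insert c P)
    (SIGMA A:Pow S. label_classes (insert x A) \<times> partial_G_partitions (S - A))
    {P \<in> partial_G_partitions (insert x S). \<exists>c\<in>P. x \<in> class_support
      (c :: ('a set \<times> ('a \<Rightarrow> 'g::group_add)) set)}"
  (is "bij_betw ?f ?D ?R")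
proof (rule bij_betw_imageI)
  have recover: "A = A' \<and> c = c' \<and> P = P'"
    if A: "A \<subseteq> S" "A' \<subseteq> S"
      and c: "c \<in> label_classes (insert x A)" "c' \<in> label_classes (insert x A')"
      and P: "P \<in> partial_G_partitions (S - A)" "P' \<in> partial_G_partitions (S - A')"
      and eq: "insert c P = insert c' P'"
    for A A' c c' and P P' :: "('a set \<times> ('a \<Rightarrow> 'g)) set set"
  proof -
    have s: "class_support c = insert x A" "class_support c' = insert x A'"
      using c by (simp_all add: class_support_label_classes)
    have x1: "x \<notin> class_support d" if "d \<in> P" for d
      using x that P(1) by (auto simp: partial_G_partitions_eq)
    have x2: "x \<notin> class_support d" if "d \<in> P'" for d
      using x that P(2) by (auto simp: partial_G_partitions_eq)
    \<comment> \<open>The support of \<open>c\<close> contains \<open>x\<close> while no support in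
      \<open>P'\<close> does; this forces \<open>c = c'\<close> below.\<close>
    have notin: "c \<notin> P" "c' \<notin> P'" "c \<notin> P'" using s x1 x2 by blast+
    have "c \<in> insert c' P'" using eq by blast
    with notin have "c = c'" by simp
    moreover have "x \<notin> A" "x \<notin> A'" using x A by auto
    with s \<open>c = c'\<close> have "A = A'" by (simp add: insert_ident)
    moreover have "P = P'" using eq notin \<open>c = c'\<close> by (simp add: insert_ident)
    ultimately show ?thesis by simp
  qed
  show "inj_on ?f ?D"
  proof (rule inj_onI)
    fix p q assume pq: "p \<in> ?D" "q \<in> ?D" "?f p = ?f q"
    obtain A c P A' c' P' where "p = (A, c, P)" "q = (A', c', P')"
      by (metis prod_cases3)
    with pq recover[of A A' c c' P P'] show "p = q" by simp
  qed
  show "?f ` ?D = ?R"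
  proof (intro subset_antisym subsetI)
    fix Q assume "Q \<in> ?f ` ?D"
    then obtain A c P where Q: "Q = insert c P" and A: "A \<subseteq> S"
      and c: "c \<in> label_classes (insert x A)" and P: "P \<in> partial_G_partitions (S - A)"
      by auto
    have s: "class_support c = insert x A" using c by (rule class_support_label_classes)
    have "class_support d \<inter> class_support c = {}" if "d \<in> P" for d
      using P that x unfolding s by (auto simp: partial_G_partitions_eq)
    then have "disjoint_family_on class_support Q"
      using P unfolding Q disjoint_family_on_def by (auto simp: partial_G_partitions_eq disjoint_family_on_def)
    then show "Q \<in> ?R"
      using P A c s by (auto simp: Q partial_G_partitions_eq)
  next
    fix Q assume Q: "Q \<in> ?R"
    then obtain c where c: "c \<in> Q" "x \<in> class_support c" by blast
    define A where "A = class_support c - {x}"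
    have s: "class_support c = insert x A" using c by (auto simp: A_def)
    have "A \<subseteq> S" using Q c by (auto simp: A_def partial_G_partitions_eq)
    moreover have "c \<in> label_classes (insert x A)"
      using Q c by (auto simp: s[symmetric] partial_G_partitions_eq)
    moreover have "Q - {c} \<in> partial_G_partitions (S - A)"
      unfolding partial_G_partitions_eq
    proof (intro CollectI conjI ballI)
      fix d assume d: "d \<in> Q - {c}"
      then have "class_support d \<inter> insert x A = {}"
        using Q c unfolding s[symmetric] by (auto simp: partial_G_partitions_eq disjoint_family_on_def)
      moreover have "class_support d \<subseteq> insert x S"
        using Q d by (simp add: partial_G_partitions_eq)
      ultimately show "class_support d \<subseteq> S - A" by blast
    qed (use Q in \<open>simp_all add: partial_G_partitions_eq disjoint_family_on_def\<close>)
    ultimately have "(A, c, Q - {c}) \<in> ?D" by auto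
    moreover have "Q = ?f (A, c, Q - {c})" using c by auto
    ultimately show "Q \<in> ?f ` ?D" by blast
  qed
qed

lemma card_partial_G_partitions_insert:
  assumes S: "finite S" "x \<notin> S" and G: "finite (UNIV :: 'g::group_add set)"
  shows "card (partial_G_partitions (insert x S) :: ('a set \<times> ('a \<Rightarrow> 'g)) set set set) =
    card (partial_G_partitions S :: ('a set \<times> ('a \<Rightarrow> 'g)) set set set) +
    (\<Sum>A\<in>Pow S. CARD('g) ^ card A *
       card (partial_G_partitions (S - A) :: ('a set \<times> ('a \<Rightarrow> 'g)) set set set))"
proof -
  let ?p = "partial_G_partitions :: 'a set \<Rightarrow> ('a set \<times> ('a \<Rightarrow> 'g)) set set set"
  let ?c = "\<lambda>A. label_classes (insert x A) :: ('a set \<times> ('a \<Rightarrow> 'g)) set set"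
  let ?R = "{P \<in> ?p (insert x S). \<exists>c\<in>P. x \<in> class_support c}"
  have fin: "finite (?p (insert x S))" "finite (?p S)"
    using S G by (auto intro: finite_partial_G_partitions)
  \<comment> \<open>A partial partition in which no block contains \<open>x\<close> is one of
    \<open>S\<close>.\<close>
  have "?p (insert x S) = ?p S \<union> ?R" "?p S \<inter> ?R = {}"
    using S by (auto simp: partial_G_partitions_eq)
  then have "card (?p (insert x S)) = card (?p S) + card ?R"
    using fin by (metis (no_types, lifting) card_Un_disjoint finite_Un)
  also have "card ?R = card (SIGMA A:Pow S. ?c A \<times> ?p (S - A))"
    by (rule bij_betw_same_card[OF bij_betw_partial_G_partitions_insert[OF S(2)], symmetric])
  also have "\<dots> = (\<Sum>A\<in>Pow S. card (?c A \<times> ?p (S - A)))"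
  proof (rule card_SigmaI)
    show "\<forall>A\<in>Pow S. finite (?c A \<times> ?p (S - A))"
    proof
      fix A assume "A \<in> Pow S"
      then have "finite (insert x A)" "finite (S - A)" using S finite_subset by auto
      with G show "finite (?c A \<times> ?p (S - A))"
        by (intro finite_cartesian_product finite_label_classes finite_partial_G_partitions)
    qed
  qed (use S in simp)
  also have "\<dots> = (\<Sum>A\<in>Pow S. CARD('g) ^ card A * card (?p (S - A)))"
  proof (intro sum.cong refl)
    fix A assume "A \<in> Pow S"
    then have "finite A" "x \<notin> A" using S finite_subset by auto
    from card_label_classes_insert[OF this G]
    show "card (?c A \<times> ?p (S - A)) = CARD('g) ^ card A * card (?p (S - A))"
      by (simp only: card_cartesian_product)
  qed
  finally show ?thesis .
qed

section \<open>Comparison of the two recurrences\<close>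

lemma UNIV_bit: "(UNIV :: bit set) = {0, 1}"
proof -
  have "b \<in> {0, 1}" for b :: bit by (cases b) simp_all
  then show ?thesis by blast
qed

lemma finite_UNIV_bit: "finite (UNIV :: bit set)"
  by (simp add: UNIV_bit)

lemma card_UNIV_bit: "CARD(bit) = 2"
  by (simp add: UNIV_bit)

text \<open>Removing the maximum gives both counts the same recurrence. It refers to
  \<open>T - W\<close> for every \<open>W\<close>, which calls for induction over all proper
  subsets.\<close>

lemma card_left_max_pairs_eq:
  assumes "finite (S :: 'a::linorder set)"
  shows "card (left_max_pairs S) =
    card (partial_G_partitions S :: ('a set \<times> ('a \<Rightarrow> bit)) set set set)"
  using assms
proof (induction S rule: finite_psubset_induct)
  case (psubset S)
  let ?p = "partial_G_partitions :: 'a set \<Rightarrow> ('a set \<times> ('a \<Rightarrow> bit)) set set set"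
  show ?case
  proof (cases "S = {}")
    case True
    have "left_max_pairs {} = {([] :: 'a list, [])}"
      by (auto simp: left_max_pairs_def peaks_left_max_def peak_def)
    moreover have "?p {} = {{}}"
      by (auto simp: partial_G_partitions_eq disjoint_family_on_def)
    ultimately show ?thesis by (simp add: True)
  next
    case False
    define T where "T = S - {Max S}"
    have "Max S \<in> S" using psubset.hyps False by (rule Max_in)
    then have S: "insert (Max S) T = S" and T: "finite T" "Max S \<notin> T"
      using psubset.hyps by (simp_all add: T_def insert_absorb)
    have lt: "\<forall>x\<in>T. x < Max S"
      using psubset.hyps Max_ge unfolding T_def by (simp add: less_le)
    have IH: "card (left_max_pairs (T - W)) = card (?p (T - W))" for W
    proof (rule psubset.IH)
      show "T - W \<subset> S" using \<open>Max S \<in> S\<close> unfolding T_def by blast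
    qed
    let ?s = "\<lambda>V. \<Sum>W\<in>V. 2 ^ card W * card (?p (T - W))"
    \<comment> \<open>The empty set is set apart: its truncated exponent is 0, so doubling gives 2
      instead of \<open>2 ^ 0\<close>.\<close>
    have *: "2 * (\<Sum>W\<in>Pow T - {{}}. 2 ^ (card W - 1) * card (?p (T - W))) = ?s (Pow T - {{}})"
      unfolding sum_distrib_left
    proof (intro sum.cong refl)
      fix W assume "W \<in> Pow T - {{}}"
      then have "0 < card W" using T by (auto simp: card_gt_0_iff dest: finite_subset)
      then obtain k where "card W = Suc k" by (metis Suc_pred)
      then show "2 * (2 ^ (card W - 1) * card (?p (T - W))) = 2 ^ card W * card (?p (T - W))"
        by simp
    qed
    have "card (left_max_pairs S) =
        2 * (\<Sum>W\<in>Pow T. 2 ^ (card W - 1) * card (?p (T - W)))"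
      using card_left_max_pairs_insert[OF T(1) lt] by (simp only: S IH)
    also have "\<dots> = 2 * card (?p T) + ?s (Pow T - {{}})"
      unfolding *[symmetric] using T by (simp add: sum.remove[of "Pow T" "{}"] distrib_left)
    \<comment> \<open>Of the two copies of \<open>card (?p T)\<close>, one becomes the summand for
      \<open>W = {}\<close>; the other counts the partial partitions with \<open>Max S\<close> in no
      block.\<close>
    also have "\<dots> = card (?p T) + ?s (Pow T)"
      using T by (simp add: sum.remove[of "Pow T" "{}"])
    also have "\<dots> = card (?p (insert (Max S) T))"
      using card_partial_G_partitions_insert[OF T finite_UNIV_bit] by (simp only: card_UNIV_bit)
    finally show ?thesis by (simp only: S)
  qed
qed

text \<open>The bijection is obtained from equal cardinalities of finite sets, not from an explicit
  map. The letter \<open>Suc n\<close> acts as the maximum above \<open>{1..n}\<close>.\<close>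

theorem corollary13:
  fixes n :: nat
  shows "\<exists>f. bij_betw f
           {\<pi> \<in> permutations_of_set {1..n + 1}. avoids \<pi> pattern_3_121_3}
           (partial_G_partitions {1..n} :: (nat set \<times> (nat \<Rightarrow> bit)) set set set)"
proof (rule finite_same_card_bij)
  have "{\<pi> \<in> permutations_of_set {1..n + 1}. avoids \<pi> pattern_3_121_3} =
      {w \<in> permutations_of_set (insert (Suc n) {1..n}). peaks_left_or_right_max w}"
    by (simp add: avoids_3_121_3_iff atLeastAtMostSuc_conv)
  also have "card \<dots> = card (left_max_pairs {1..n})"
    by (intro bij_betw_same_card[OF bij_betw_left_max_pairs, symmetric]) auto
  also have "\<dots> = card (partial_G_partitions {1..n} :: (nat set \<times> (nat \<Rightarrow> bit)) set set set)"
    by (intro card_left_max_pairs_eq) auto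
  finally show "card {\<pi> \<in> permutations_of_set {1..n + 1}. avoids \<pi> pattern_3_121_3} =
      card (partial_G_partitions {1..n} :: (nat set \<times> (nat \<Rightarrow> bit)) set set set)" .
  show "finite (partial_G_partitions {1..n} :: (nat set \<times> (nat \<Rightarrow> bit)) set set set)"
    by (intro finite_partial_G_partitions finite_UNIV_bit finite_atLeastAtMost)
qed simp

end
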